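(* Let $q$ be a prime power and $n$ a positive even integer. Let $\Omega_{q,n}$ be the set of all distinct double Toeplitz $[n,n/2]$ codes over $\mathbb{F}_q$, and let $\Psi_{q,n}(y)=\sum_{C\in\Omega_{q,n}} W_C(y)$. Then \[ \Psi_{q,n}(y)=q^{n-1}+q^{\frac{n}{2}-1}\left(\sum_{j=1}^{n/2}\left(\binom{n}{j}-\binom{n/2}{j}\right)(q-1)^j y^j+\sum_{j=n/2+1}^{n}\binom{n}{j}(q-1)^j y^j\right). \]
   Context: For $m\ge1$, $t\in\mathbb{F}_q$, $a=(a_1,\dots,a_{m-1})$, $b=(b_1,\dots,b_{m-1})\in\mathbb{F}_q^{m-1}$, the Toeplitz matrix $T(t,a,b)$ is the $m\times m$ matrix whose $(i,j)$ entry is $t$ if $i=j$, $a_{j-i}$ if $j>i$, and $b_{i-j}$ if $i>j$. The double Toeplitz code $\mathcal{T}(t,a,b)$ is the linear $[2m,m]$ code over $\mathbb{F}_q$ with generator matrix $(I_m\mid T(t,a,b))$; a double Toeplitz $[n,n/2]$ code is such a code with $m=n/2$, and "distinct" means distinct as subsets of $\mathbb{F}_q^n$. The weight enumerator of a code $C$ is $W_C(y)=\sum_{c\in C}y^{\mathrm{wt}(c)}$, where $\mathrm{wt}$ is Hamming weight. $\Psi_{q,n}$ is called the average weight enumerator of double Toeplitz $[n,n/2]$ codes. *)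

theory Defs
  imports
    "Jordan_Normal_Form.VS_Connect"
    "HOL-Computational_Algebra.Polynomial"
    "HOL-Library.Cardinality"
begin

text \<open>
  Rows and columns are numbered from 0, and the parameter written \<open>a_k\<close> (\<open>1 \<le> k \<le> m - 1\<close>)
  in the literature is the entry \<open>a $ (k - 1)\<close> of a vector of dimension \<open>m - 1\<close>.
\<close>

definition toeplitz_mat :: "nat \<Rightarrow> 'a \<Rightarrow> 'a vec \<Rightarrow> 'a vec \<Rightarrow> 'a mat" where
  "toeplitz_mat m t a b = mat m m (\<lambda>(i, j).
     if i = j then t else if i < j then a $ (j - i - 1) else b $ (i - j - 1))"

definition double_toeplitz_gen :: "nat \<Rightarrow> 'a::field \<Rightarrow> 'a vec \<Rightarrow> 'a vec \<Rightarrow> 'a mat" where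
  "double_toeplitz_gen m t a b = mat m (2 * m) (\<lambda>(i, j).
     if j < m then 1\<^sub>m m $$ (i, j) else toeplitz_mat m t a b $$ (i, j - m))"

definition double_toeplitz_code :: "nat \<Rightarrow> 'a::field \<Rightarrow> 'a vec \<Rightarrow> 'a vec \<Rightarrow> 'a vec set" where
  "double_toeplitz_code m t a b = vec_space.row_space (2 * m) (double_toeplitz_gen m t a b)"

definition double_toeplitz_codes :: "nat \<Rightarrow> 'a::field vec set set" where
  "double_toeplitz_codes n = {double_toeplitz_code (n div 2) t a b | t a b.
     a \<in> carrier_vec (n div 2 - 1) \<and> b \<in> carrier_vec (n div 2 - 1)}"

definition hamming_weight :: "'a::zero vec \<Rightarrow> nat" where
  "hamming_weight v = card {i. i < dim_vec v \<and> v $ i \<noteq> 0}"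

definition weight_enumerator :: "'a::zero vec set \<Rightarrow> int poly" where
  "weight_enumerator C = (\<Sum>c\<in>C. Polynomial.monom 1 (hamming_weight c))"

definition average_weight_enumerator :: "'a::{field,finite} itself \<Rightarrow> nat \<Rightarrow> int poly" where
  "average_weight_enumerator _ n =
     (\<Sum>C\<in>(double_toeplitz_codes n :: 'a vec set set). weight_enumerator C)"

end

theory Submission
  imports Defs "HOL-Library.FuncSet"
begin

text \<open>
  A Toeplitz matrix is \<open>T i j = c (m - 1 + j - i)\<close> for a unique sequence \<open>c\<close> of length \<open>2m - 1\<close>,
  and \<open>c\<close> can be recovered from the code. Exchanging the order of summation, fix the
  message \<open>u\<close>. If \<open>u = 0\<close>, every \<open>c\<close> contributes the zero word. If \<open>u \<noteq> 0\<close> has its first nonzero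
  entry at \<open>r\<close>, then \<open>(u T) j\<close> involves \<open>c (m - 1 + j - r)\<close> with a nonzero coefficient and otherwise
  only entries of \<open>c\<close> of smaller index; so \<open>u T\<close> together with the \<open>m - 1\<close> entries of \<open>c\<close>
  outside the window of these indices determines \<open>c\<close>, and every vector is \<open>u T\<close> for exactly
  \<open>q ^ (m - 1)\<close> matrices. Hence the sum equals
  \<open>q ^ (2m - 1) + q ^ (m - 1) * ((1 + (q - 1) y) ^ (2m) - (1 + (q - 1) y) ^ m)\<close>.
\<close>

section \<open>Sequences in place of Toeplitz matrices, and the encoding map\<close>

abbreviation tuples :: "nat \<Rightarrow> (nat \<Rightarrow> 'a) set" where
  "tuples d \<equiv> {..<d} \<rightarrow>\<^sub>E UNIV"

text \<open>The offset \<open>m - 1\<close> makes the natural subtraction exact for all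
  \<open>i < m\<close>; for \<open>i, j < m\<close> the index runs through 0 to
  \<open>2 * m - 2\<close>, one value per diagonal.\<close>

definition toeplitz_conv :: "nat \<Rightarrow> (nat \<Rightarrow> 'a::field) \<Rightarrow> (nat \<Rightarrow> 'a) \<Rightarrow> nat \<Rightarrow> 'a" where
  "toeplitz_conv m c u j = (\<Sum>i<m. u i * c (m - 1 + j - i))"

definition toeplitz_encode :: "nat \<Rightarrow> (nat \<Rightarrow> 'a::field) \<Rightarrow> (nat \<Rightarrow> 'a) \<Rightarrow> 'a vec" where
  "toeplitz_encode m c u = vec (2 * m) (\<lambda>k. if k < m then u k else toeplitz_conv m c u (k - m))"

text \<open>Written as a product over coordinates, y to the Hamming weight splits along the two
  halves of a codeword, and its sum over all tuples factors.\<close>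

definition weight_monom :: "nat \<Rightarrow> (nat \<Rightarrow> 'a::zero) \<Rightarrow> int poly" where
  "weight_monom d f = (\<Prod>k<d. if f k = 0 then 1 else Polynomial.monom 1 1)"

text \<open>The row space is the range of the transposed generator matrix; its identity block
  reproduces the message and its Toeplitz block yields the convolution. Only the matrix entries are
  assumed of \<open>c\<close>, so the lemma serves both for \<open>c\<close> built from
  \<open>t\<close>, \<open>a\<close>, \<open>b\<close> and for \<open>t\<close>, \<open>a\<close>,
  \<open>b\<close> read off from \<open>c\<close>.\<close>

lemma double_toeplitz_code_eq_image:
  fixes c :: "nat \<Rightarrow> 'a::field"
  assumes c: "\<And>i j. i < m \<Longrightarrow> j < m \<Longrightarrow> toeplitz_mat m t a b $$ (i, j) = c (m - 1 + j - i)"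
  shows "double_toeplitz_code m t a b = toeplitz_encode m c ` tuples m"
proof -
  let ?G = "double_toeplitz_gen m t a b"
  have G: "?G \<in> carrier_mat m (2 * m)"
    by (simp add: double_toeplitz_gen_def)
  have mult: "?G\<^sup>T *\<^sub>v y = toeplitz_encode m c (\<lambda>i. y $ i)" if y: "y \<in> carrier_vec m" for y
  proof (rule eq_vecI)
    show "dim_vec (?G\<^sup>T *\<^sub>v y) = dim_vec (toeplitz_encode m c (\<lambda>i. y $ i))"
      using G by (simp add: toeplitz_encode_def)
    fix k assume "k < dim_vec (toeplitz_encode m c (\<lambda>i. y $ i))"
    then have k: "k < 2 * m"
      by (simp add: toeplitz_encode_def)
    have "(?G\<^sup>T *\<^sub>v y) $ k = (\<Sum>i<m. ?G $$ (i, k) * y $ i)"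
      using G y k by (simp add: scalar_prod_def lessThan_atLeast0)
    also have "\<dots> = toeplitz_encode m c (\<lambda>i. y $ i) $ k"
    proof (cases "k < m")
      case True
      have "(\<Sum>i<m. ?G $$ (i, k) * y $ i) = (\<Sum>i<m. if i = k then y $ i else 0)"
        using True k by (intro sum.cong) (auto simp: double_toeplitz_gen_def)
      then show ?thesis
        using True k by (simp add: toeplitz_encode_def)
    next
      case False
      have "(\<Sum>i<m. ?G $$ (i, k) * y $ i) = toeplitz_conv m c (\<lambda>i. y $ i) (k - m)"
        unfolding toeplitz_conv_def
        using False k c by (intro sum.cong) (auto simp: double_toeplitz_gen_def)
      then show ?thesis
        using False k by (simp add: toeplitz_encode_def)
    qed
    finally show "(?G\<^sup>T *\<^sub>v y) $ k = toeplitz_encode m c (\<lambda>i. y $ i) $ k" .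
  qed
  \<comment> \<open>Vectors and extensional functions differ outside the index range, which the
    encoding never inspects.\<close>
  have encode_cong: "toeplitz_encode m c u = toeplitz_encode m c u'"
    if "\<And>i. i < m \<Longrightarrow> u i = u' i" for u u'
    using that by (auto simp: toeplitz_encode_def toeplitz_conv_def intro!: eq_vecI sum.cong)
  have "double_toeplitz_code m t a b = (\<lambda>y. ?G\<^sup>T *\<^sub>v y) ` carrier_vec m"
    using G unfolding double_toeplitz_code_def vec_space.row_space_eq[OF G] by auto
  also have "\<dots> = (\<lambda>y. toeplitz_encode m c (\<lambda>i. y $ i)) ` carrier_vec m"
    by (intro image_cong) (auto simp: mult)
  also have "\<dots> = toeplitz_encode m c ` tuples m"
  proof (intro subset_antisym subsetI)
    fix x assume "x \<in> (\<lambda>y. toeplitz_encode m c (\<lambda>i. y $ i)) ` carrier_vec m"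
    then obtain y where "x = toeplitz_encode m c (\<lambda>i. y $ i)" by blast
    also have "\<dots> = toeplitz_encode m c (restrict (\<lambda>i. y $ i) {..<m})"
      by (rule encode_cong) auto
    finally show "x \<in> toeplitz_encode m c ` tuples m" by auto
  next
    fix x assume "x \<in> toeplitz_encode m c ` tuples m"
    then obtain u where "x = toeplitz_encode m c u" by blast
    also have "\<dots> = toeplitz_encode m c (\<lambda>i. vec m u $ i)"
      by (rule encode_cong) auto
    finally show "x \<in> (\<lambda>y. toeplitz_encode m c (\<lambda>i. y $ i)) ` carrier_vec m" by auto
  qed
  finally show ?thesis .
qed

lemma double_toeplitz_codes_eq_image:
  assumes "m > 0"
  shows "(double_toeplitz_codes (2 * m) :: 'a::field vec set set) =
    (\<lambda>c. toeplitz_encode m c ` tuples m) ` tuples (2 * m - 1)"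
proof (intro subset_antisym subsetI)
  fix C :: "'a vec set"
  assume "C \<in> double_toeplitz_codes (2 * m)"
  then obtain t a b where C: "C = double_toeplitz_code m t a b"
    by (auto simp: double_toeplitz_codes_def)
  \<comment> \<open>Index \<open>m - 1\<close> is the main diagonal; above it come the entries of
    \<open>a\<close> in order, below it those of \<open>b\<close> in reverse.\<close>
  define c where "c = restrict (\<lambda>k. if k = m - 1 then t else if m \<le> k then a $ (k - m)
    else b $ (m - 2 - k)) {..<2 * m - 1}"
  have "C = toeplitz_encode m c ` tuples m"
    unfolding C
  proof (rule double_toeplitz_code_eq_image)
    fix i j assume ij: "i < m" "j < m"
    then have "m - Suc 0 + j - i - m = j - i - 1" "j < i \<Longrightarrow> m - 2 - (m - Suc 0 + j - i) = i - j - 1"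
      by auto
    with ij show "toeplitz_mat m t a b $$ (i, j) = c (m - 1 + j - i)"
      by (auto simp: toeplitz_mat_def c_def)
  qed
  moreover have "c \<in> tuples (2 * m - 1)"
    by (auto simp: c_def)
  ultimately show "C \<in> (\<lambda>c. toeplitz_encode m c ` tuples m) ` tuples (2 * m - 1)"
    by blast
next
  fix C :: "'a vec set"
  assume "C \<in> (\<lambda>c. toeplitz_encode m c ` tuples m) ` tuples (2 * m - 1)"
  then obtain c where C: "C = toeplitz_encode m c ` tuples m"
    by auto
  let ?a = "vec (m - 1) (\<lambda>k. c (m + k))" and ?b = "vec (m - 1) (\<lambda>k. c (m - 2 - k))"
  have "double_toeplitz_code m (c (m - 1)) ?a ?b = C"
    unfolding C
  proof (rule double_toeplitz_code_eq_image)
    fix i j assume ij: "i < m" "j < m"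
    then have "i < j \<Longrightarrow> m + (j - Suc i) = m - Suc 0 + j - i"
      "j < i \<Longrightarrow> m - 2 - (i - Suc j) = m - Suc 0 + j - i"
      by auto
    with ij show "toeplitz_mat m (c (m - 1)) ?a ?b $$ (i, j) = c (m - 1 + j - i)"
      by (auto simp: toeplitz_mat_def)
  qed
  then show "C \<in> double_toeplitz_codes (2 * m)"
    unfolding double_toeplitz_codes_def by fastforce
qed

section \<open>Recovering the message and the sequence\<close>

lemma toeplitz_encode_eqD:
  assumes "toeplitz_encode m c u = toeplitz_encode m c' u'" and "k < m"
  shows "u k = u' k" and "toeplitz_conv m c u k = toeplitz_conv m c' u' k"
proof -
  have *: "toeplitz_encode m c u $ i = toeplitz_encode m c' u' $ i" for i
    using assms by simp
  show "u k = u' k"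
    using *[of k] assms by (simp add: toeplitz_encode_def)
  show "toeplitz_conv m c u k = toeplitz_conv m c' u' k"
    using *[of "m + k"] assms by (simp add: toeplitz_encode_def)
qed

text \<open>The encoding is systematic: the first \<open>m\<close> coordinates are the
  message.\<close>

lemma inj_on_toeplitz_encode: "inj_on (toeplitz_encode m c) (tuples m)"
  by (intro inj_onI PiE_ext) (auto dest: toeplitz_encode_eqD(1))

text \<open>The codewords of the unit messages are the rows of the generator matrix.\<close>

lemma inj_on_toeplitz_code:
  assumes "m > 0"
  shows "inj_on (\<lambda>c. toeplitz_encode m c ` tuples m) (tuples (2 * m - 1) :: (nat \<Rightarrow> 'a::field) set)"
proof (intro inj_onI PiE_ext)
  fix c c' :: "nat \<Rightarrow> 'a" and l
  assume eq: "toeplitz_encode m c ` tuples m = toeplitz_encode m c' ` tuples m"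
    and l: "l \<in> {..<2 * m - 1}"
  \<comment> \<open>Every diagonal meets the first column or the first row: \<open>(i, j)\<close> is
    the position there that carries \<open>c l\<close>.\<close>
  define i where "i = (if l < m then m - 1 - l else 0)"
  define j where "j = (if l < m then 0 else l - (m - 1))"
  have ij: "i < m" "j < m" "m - 1 + j - i = l"
    using l assms by (auto simp: i_def j_def)
  define e where "e = restrict (\<lambda>k. if k = i then 1 else (0::'a)) {..<m}"
  have conv_e: "toeplitz_conv m d e j = d l" for d
  proof -
    have "toeplitz_conv m d e j = (\<Sum>k<m. if k = i then d l else 0)"
      unfolding toeplitz_conv_def using ij by (intro sum.cong) (auto simp: e_def)
    then show ?thesis using ij by simp
  qed
  have "e \<in> tuples m"
    by (auto simp: e_def)
  with eq obtain u where u: "u \<in> tuples m" "toeplitz_encode m c e = toeplitz_encode m c' u"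
    by (metis (no_types, lifting) image_iff)
  \<comment> \<open>The word of \<open>e\<close> could a priori come from another message under
    \<open>c'\<close>; the systematic half rules this out.\<close>
  have "e k = u k" if "k \<in> {..<m}" for k
    using toeplitz_encode_eqD(1)[OF u(2)] that by simp
  then have "u = e"
    using \<open>e \<in> tuples m\<close> u(1) by (metis PiE_ext)
  with toeplitz_encode_eqD(2)[OF u(2) ij(2)]
  have "toeplitz_conv m c e j = toeplitz_conv m c' e j"
    by simp
  then show "c l = c' l"
    by (simp add: conv_e)
qed assumption+

section \<open>Weights as products over coordinates\<close>

lemma monom_hamming_weight:
  "Polynomial.monom 1 (hamming_weight (vec d f)) = weight_monom d f"
proof -
  have "weight_monom d f = (\<Prod>k | k < d \<and> f k \<noteq> 0. Polynomial.monom 1 1)"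
    unfolding weight_monom_def by (rule prod.mono_neutral_cong_right) auto
  moreover have "hamming_weight (vec d f) = card {k. k < d \<and> f k \<noteq> 0}"
    unfolding hamming_weight_def by (rule arg_cong[where f = card]) auto
  ultimately show ?thesis
    by (simp add: monom_power)
qed

lemma prod_lessThan_add:
  fixes g :: "nat \<Rightarrow> 'b::comm_monoid_mult"
  shows "(\<Prod>k<m + d. g k) = (\<Prod>k<m. g k) * (\<Prod>k<d. g (m + k))"
  by (induction d) (simp_all add: mult.assoc)

lemma weight_monom_cong:
  "(\<And>k. k < d \<Longrightarrow> f k = g k) \<Longrightarrow> weight_monom d f = weight_monom d g"
  unfolding weight_monom_def by (intro prod.cong) auto

lemma monom_hamming_weight_toeplitz_encode:
  "Polynomial.monom 1 (hamming_weight (toeplitz_encode m c u)) =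
    weight_monom m u * weight_monom m (toeplitz_conv m c u)"
  unfolding toeplitz_encode_def monom_hamming_weight weight_monom_def mult_2 prod_lessThan_add
  by (intro arg_cong2[where f = times] prod.cong) auto

lemma card_tuples: "card (tuples d :: (nat \<Rightarrow> 'a::finite) set) = CARD('a) ^ d"
  by (simp add: card_PiE)

text \<open>By distributivity each coordinate contributes a factor: 1 from the zero entry and y from
  each of the q - 1 nonzero ones.\<close>

lemma sum_weight_monom:
  "(\<Sum>f\<in>(tuples d :: (nat \<Rightarrow> 'a::{zero,finite}) set). weight_monom d f) =
    (1 + Polynomial.monom (int CARD('a) - 1) 1) ^ d"
proof -
  let ?g = "\<lambda>x::'a. if x = 0 then 1 else (Polynomial.monom 1 1 :: int poly)"
  have "(\<Sum>x\<in>UNIV. ?g x) = 1 + (\<Sum>x\<in>UNIV - {0::'a}. Polynomial.monom 1 1)"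
    by (subst sum.remove[of _ 0]) auto
  also have "\<dots> = 1 + Polynomial.monom (int CARD('a) - 1) 1"
    by (simp add: card_Diff_singleton of_nat_diff Suc_leI of_nat_poly
        mult_monom smult_monom flip: monom_0)
  finally have "(\<Sum>x\<in>UNIV. ?g x) = 1 + Polynomial.monom (int CARD('a) - 1) 1" .
  moreover have "(\<Sum>f\<in>(tuples d :: (nat \<Rightarrow> 'a) set). weight_monom d f) = (\<Prod>k<d. \<Sum>x\<in>UNIV. ?g x)"
    unfolding weight_monom_def by (subst prod_sum_PiE) auto
  ultimately show ?thesis by simp
qed

section \<open>Counting the sequences with a prescribed product\<close>

lemma toeplitz_conv_window_inj:
  fixes c c' u :: "nat \<Rightarrow> 'a::field"
  assumes r: "r < m" "u r \<noteq> 0" "\<And>i. i < r \<Longrightarrow> u i = 0"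
    and conv: "\<And>j. j < m \<Longrightarrow> toeplitz_conv m c u j = toeplitz_conv m c' u j"
    and out: "\<And>l. l < 2 * m - 1 \<Longrightarrow> l \<notin> {m - 1 - r..<2 * m - 1 - r} \<Longrightarrow> c l = c' l"
    and "l < 2 * m - 1"
  shows "c l = c' l"
  using \<open>l < 2 * m - 1\<close>
\<comment> \<open>The equations form a triangular system: each determines one window entry from
  entries of smaller index.\<close>
proof (induction l rule: less_induct)
  case (less l)
  show ?case
  proof (cases "l \<in> {m - 1 - r..<2 * m - 1 - r}")
    case True
    \<comment> \<open>The equation whose leading unknown is \<open>c l\<close>.\<close>
    define j where "j = l - (m - 1 - r)"
    have j: "j < m" "m - 1 + j - r = l"
      using True r by (auto simp: j_def)
    have split: "toeplitz_conv m d u j = u r * d l + (\<Sum>i\<in>{..<m} - {r}. u i * d (m - 1 + j - i))"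
      for d
      unfolding toeplitz_conv_def using r j by (subst sum.remove[of _ r]) auto
    \<comment> \<open>Terms with \<open>i < r\<close> vanish; those with \<open>i > r\<close> have
      index below \<open>l\<close>, so the induction hypothesis applies.\<close>
    have "u i * c (m - 1 + j - i) = u i * c' (m - 1 + j - i)" if "i \<in> {..<m} - {r}" for i
    proof (cases "i < r")
      case False
      with that have "r < i" "i < m" by auto
      then have "m - 1 + j - i < l" using j by linarith
      then show ?thesis using less by simp
    qed (simp add: r)
    then have "(\<Sum>i\<in>{..<m} - {r}. u i * c (m - 1 + j - i)) =
        (\<Sum>i\<in>{..<m} - {r}. u i * c' (m - 1 + j - i))"
      by (intro sum.cong) auto
    with conv[OF j(1)] r show ?thesis
      by (simp add: split)
  qed (use less out in auto)
qed

text \<open>Each tuple is the product for exactly \<open>CARD('a) ^ (m - 1)\<close> sequences, one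
  per choice of the entries outside the window. The restriction makes the product an extensional
  tuple, over which \<open>h\<close> can be summed.\<close>

lemma sum_toeplitz_conv:
  fixes u :: "nat \<Rightarrow> 'a::{field,finite}" and h :: "(nat \<Rightarrow> 'a) \<Rightarrow> 'b::comm_semiring_1"
  assumes "i < m" "u i \<noteq> 0"
  shows "(\<Sum>c\<in>tuples (2 * m - 1). h (restrict (toeplitz_conv m c u) {..<m})) =
    of_nat (CARD('a) ^ (m - 1)) * (\<Sum>v\<in>tuples m. h v)"
proof -
  define r where "r = (LEAST i. u i \<noteq> 0)"
  have "r \<le> i"
    unfolding r_def using assms(2) by (rule Least_le)
  moreover have "u r \<noteq> 0"
    unfolding r_def using assms(2) by (rule LeastI)
  moreover have "u k = 0" if "k < r" for k
    using that not_less_Least unfolding r_def by blast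
  ultimately have r: "r < m" "u r \<noteq> 0" "\<And>i. i < r \<Longrightarrow> u i = 0"
    using assms(1) by auto
  \<comment> \<open>Since \<open>r < m\<close>, the window is a set of \<open>m\<close> of the
    \<open>2 * m - 1\<close> indices, which leaves \<open>m - 1\<close> free ones.\<close>
  define K where "K = {..<2 * m - 1} - {m - 1 - r..<2 * m - 1 - r}"
  have "{m - 1 - r..<2 * m - 1 - r} \<subseteq> {..<2 * m - 1}"
    by auto
  then have "card K = m - 1" and [simp]: "finite K"
    using r(1) by (simp_all add: K_def card_Diff_subset)
  then have card_K: "card (K \<rightarrow>\<^sub>E (UNIV :: 'a set)) = CARD('a) ^ (m - 1)"
    by (simp add: card_PiE)
  let ?\<phi> = "\<lambda>c. (restrict (toeplitz_conv m c u) {..<m}, restrict c K)"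
  have inj: "inj_on ?\<phi> (tuples (2 * m - 1))"
  proof (intro inj_onI PiE_ext)
    fix c c' :: "nat \<Rightarrow> 'a" and l
    assume eq: "?\<phi> c = ?\<phi> c'" and l: "l \<in> {..<2 * m - 1}"
    show "c l = c' l"
    proof (rule toeplitz_conv_window_inj[where u = u, OF r])
      show "toeplitz_conv m c u j = toeplitz_conv m c' u j" if "j < m" for j
        using eq that by (metis (no_types, lifting) lessThan_iff prod.inject restrict_apply')
      show "c l = c' l" if "l < 2 * m - 1" "l \<notin> {m - 1 - r..<2 * m - 1 - r}" for l
      proof -
        have "l \<in> K" using that by (simp add: K_def)
        then show ?thesis using eq by (metis (no_types, lifting) prod.inject restrict_apply')
      qed
    qed (use l in auto)
  qed assumption+
  \<comment> \<open>Surjectivity comes from counting: both sides have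
    \<open>CARD('a) ^ (2 * m - 1)\<close> elements.\<close>
  have "?\<phi> ` tuples (2 * m - 1) = tuples m \<times> (K \<rightarrow>\<^sub>E UNIV)"
  proof (rule card_subset_eq)
    show "finite ((tuples m :: (nat \<Rightarrow> 'a) set) \<times> (K \<rightarrow>\<^sub>E (UNIV :: 'a set)))"
      by (intro finite_cartesian_product finite_PiE) simp_all
    show "?\<phi> ` tuples (2 * m - 1) \<subseteq> tuples m \<times> (K \<rightarrow>\<^sub>E UNIV)"
      by (intro image_subsetI SigmaI) simp_all
    have "m + (m - 1) = 2 * m - 1" using r(1) by simp
    then show "card (?\<phi> ` tuples (2 * m - 1)) =
        card ((tuples m :: (nat \<Rightarrow> 'a) set) \<times> (K \<rightarrow>\<^sub>E (UNIV :: 'a set)))"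
      by (simp only: card_image[OF inj] card_cartesian_product card_K card_tuples flip: power_add)
  qed
  with inj have bij: "bij_betw ?\<phi> (tuples (2 * m - 1)) (tuples m \<times> (K \<rightarrow>\<^sub>E UNIV))"
    by (simp add: bij_betw_def)
  have "(\<Sum>c\<in>tuples (2 * m - 1). h (restrict (toeplitz_conv m c u) {..<m})) =
      (\<Sum>p\<in>tuples m \<times> (K \<rightarrow>\<^sub>E (UNIV :: 'a set)). h (fst p))"
    using sum.reindex_bij_betw[OF bij, of "\<lambda>p. h (fst p)"] by simp
  also have "\<dots> = (\<Sum>v\<in>tuples m. \<Sum>w\<in>K \<rightarrow>\<^sub>E (UNIV :: 'a set). h v)"
    by (simp only: sum.cartesian_product case_prod_unfold)
  also have "\<dots> = of_nat (CARD('a) ^ (m - 1)) * (\<Sum>v\<in>tuples m. h v)"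
    by (simp only: sum_constant card_K sum_distrib_left)
  finally show ?thesis .
qed

section \<open>Summation over sequences and messages\<close>

lemma average_weight_enumerator_closed_form:
  assumes m: "m > 0" and q: "q = CARD('a::{field,finite})"
  defines "E \<equiv> 1 + Polynomial.monom (int q - 1) 1"
  shows "average_weight_enumerator TYPE('a) (2 * m) =
    of_nat (q ^ (2 * m - 1)) + of_nat (q ^ (m - 1)) * (E ^ (2 * m) - E ^ m)"
proof -
  let ?U = "tuples m :: (nat \<Rightarrow> 'a) set" and ?C = "tuples (2 * m - 1) :: (nat \<Rightarrow> 'a) set"
  define z :: "nat \<Rightarrow> 'a" where "z = restrict (\<lambda>_. 0) {..<m}"
  have z: "z \<in> ?U" by (auto simp: z_def)
  have fin: "finite ?U" by (auto intro: finite_PiE)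
  have wz: "weight_monom m z = 1"
    by (simp add: weight_monom_def z_def)
  have sumU: "(\<Sum>u\<in>?U. weight_monom m u) = E ^ m"
    by (simp only: sum_weight_monom E_def q)
  \<comment> \<open>The contribution of the message \<open>u\<close>, taken over all codes.\<close>
  define S where "S u = (\<Sum>c\<in>?C. weight_monom m u * weight_monom m (toeplitz_conv m c u))" for u
  have Sz: "S z = of_nat (q ^ (2 * m - 1))"
  proof -
    have "toeplitz_conv m c z j = 0" for c j
      unfolding toeplitz_conv_def by (rule sum.neutral) (simp add: z_def)
    then have "weight_monom m (toeplitz_conv m c z) = 1" for c
      by (simp add: weight_monom_def)
    then show ?thesis by (simp add: S_def wz card_tuples q)
  qed
  have Snz: "S u = of_nat (q ^ (m - 1)) * E ^ m * weight_monom m u" if "u \<in> ?U - {z}" for u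
  proof -
    have "\<exists>i<m. u i \<noteq> 0"
    proof (rule ccontr)
      assume "\<not> (\<exists>i<m. u i \<noteq> 0)"
      then have "u i = z i" if "i \<in> {..<m}" for i
        using that by (simp add: z_def)
      moreover have "u \<in> ?U"
        using that by blast
      ultimately have "u = z"
        using z by (metis PiE_ext)
      with that show False by simp
    qed
    then obtain i where i: "i < m" "u i \<noteq> 0" by blast
    have "S u = weight_monom m u *
        (\<Sum>c\<in>?C. weight_monom m (restrict (toeplitz_conv m c u) {..<m}))"
      unfolding S_def sum_distrib_left
      by (intro sum.cong arg_cong2[where f = times] weight_monom_cong) auto
    also have "\<dots> = weight_monom m u * (of_nat (q ^ (m - 1)) * E ^ m)"
      by (simp only: sum_toeplitz_conv[where u = u, OF i] sumU q)
    finally show ?thesis by (simp only: ac_simps)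
  qed
  \<comment> \<open>Distinct sequences give distinct codes, so the sum over the set of codes becomes
    a sum over sequences without multiplicities.\<close>
  have "average_weight_enumerator TYPE('a) (2 * m) =
      (\<Sum>c\<in>?C. weight_enumerator (toeplitz_encode m c ` ?U))"
    unfolding average_weight_enumerator_def double_toeplitz_codes_eq_image[OF m]
    by (subst sum.reindex[OF inj_on_toeplitz_code[OF m]]) simp
  also have "\<dots> = (\<Sum>c\<in>?C. \<Sum>u\<in>?U. weight_monom m u * weight_monom m (toeplitz_conv m c u))"
    unfolding weight_enumerator_def
    by (subst sum.reindex[OF inj_on_toeplitz_encode])
      (simp add: monom_hamming_weight_toeplitz_encode)
  also have "\<dots> = (\<Sum>u\<in>?U. S u)"
    unfolding S_def by (rule sum.swap)
  also have "\<dots> = S z + (\<Sum>u\<in>?U - {z}. S u)"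
    by (rule sum.remove[OF fin z])
  also have "(\<Sum>u\<in>?U - {z}. S u) =
      of_nat (q ^ (m - 1)) * E ^ m * (\<Sum>u\<in>?U - {z}. weight_monom m u)"
    by (simp only: sum_distrib_left Snz cong: sum.cong)
  \<comment> \<open>The zero message accounts for the 1 removed from \<open>E ^ m\<close>.\<close>
  also have "(\<Sum>u\<in>?U - {z}. weight_monom m u) = E ^ m - 1"
    using sum.remove[OF fin z, of "weight_monom m"] by (simp add: sumU wz)
  finally have "average_weight_enumerator TYPE('a) (2 * m) =
      S z + of_nat (q ^ (m - 1)) * E ^ m * (E ^ m - 1)" .
  moreover have "E ^ (2 * m) = E ^ m * E ^ m"
    by (simp add: mult_2 power_add)
  ultimately show ?thesis
    by (simp only: Sz right_diff_distrib mult.assoc mult_1_right)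
qed

section \<open>Binomial expansion of the closed form\<close>

lemma one_plus_monom_power:
  fixes a :: "'a::comm_semiring_1"
  shows "(1 + Polynomial.monom a 1) ^ d =
    (\<Sum>j\<le>d. Polynomial.monom (of_nat (d choose j) * a ^ j) j)"
proof -
  have "(1 + Polynomial.monom a 1) ^ d =
      (\<Sum>j\<le>d. of_nat (d choose j) * Polynomial.monom a 1 ^ j * 1 ^ (d - j))"
    unfolding add.commute[of 1] by (rule binomial_ring)
  also have "\<dots> = (\<Sum>j\<le>d. Polynomial.monom (of_nat (d choose j) * a ^ j) j)"
    by (simp add: monom_power of_nat_poly smult_monom)
  finally show ?thesis .
qed

theorem theorem3p3:
  fixes q n :: nat
  assumes "CARD('a::{field,finite}) = q"
    and "n > 0" and "even n"
  shows "average_weight_enumerator TYPE('a) n =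
    Polynomial.monom (int q ^ (n - 1)) 0 +
    Polynomial.smult (int q ^ (n div 2 - 1))
      ((\<Sum>j = 1..n div 2. Polynomial.monom ((int (n choose j) - int ((n div 2) choose j)) * (int q - 1) ^ j) j) +
       (\<Sum>j = n div 2 + 1..n. Polynomial.monom (int (n choose j) * (int q - 1) ^ j) j))"
proof -
  define m where "m = n div 2"
  have n: "n = 2 * m" and m: "m > 0"
    using assms by (auto simp: m_def)
  let ?f = "\<lambda>d j. Polynomial.monom (int (d choose j) * (int q - 1) ^ j) j"
  let ?E = "1 + Polynomial.monom (int q - 1) 1"
  \<comment> \<open>The term for j = 0 is split off because it cancels in the difference of the two
    powers.\<close>
  have pow: "?E ^ d = 1 + (\<Sum>j = 1..d. ?f d j)" for d
  proof -
    have "?E ^ d = (\<Sum>j = 0..d. ?f d j)"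
      unfolding atLeast0AtMost by (rule one_plus_monom_power)
    then show ?thesis
      by (simp add: sum.atLeast_Suc_atMost)
  qed
  have "(\<Sum>j = 1..n. ?f n j) = (\<Sum>j = 1..m. ?f n j) + (\<Sum>j = m + 1..n. ?f n j)"
    using n sum.ub_add_nat[of 1 m "?f n" m] by (simp add: mult_2)
  then have "?E ^ (2 * m) - ?E ^ m =
      (\<Sum>j = 1..m. Polynomial.monom ((int (n choose j) - int (m choose j)) * (int q - 1) ^ j) j) +
      (\<Sum>j = m + 1..n. ?f n j)"
    unfolding pow n[symmetric]
    by (simp add: sum_subtractf left_diff_distrib flip: diff_monom)
  then show ?thesis
    using average_weight_enumerator_closed_form[OF m assms(1)[symmetric], unfolded of_nat_poly]
    by (simp add: n monom_0)
qed

end
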